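(* Let $X$ be an abstract state space, let $Q$ be a projection on $X$, and let $\mathcal{T}=(T_t)_{t\ge0}\in\Xi(X)$ be mean-$Q$-ergodic. Then the following statements are equivalent: (i) $\mathcal{T}$ is uniform mean-$Q$-ergodic; (ii) there exists $t_0\in\mathbb{R}_+$ such that $\delta_Q(\mathcal{A}_{t_0}(\mathcal{T}))<1$. Moreover, with $t_0$ as in (ii), for all $t>0$, $$\|\mathcal{A}_t(\mathcal{T})-Q\|\le\frac{2t_0}{1-\delta_Q(\mathcal{A}_{t_0}(\mathcal{T}))}\,\frac1t .$$
   Context: Abstract state space: $X$ is an ordered (real) vector space with a generating positive cone $X_+$ (i.e. $X=X_+-X_+$), and $f$ is a strictly positive linear functional on $X$ such that $\mathcal{K}=\{x\in X_+: f(x)=1\}$ is a base of $X_+$. With $U:=\mathrm{conv}(\mathcal{K}\cup(-\mathcal{K}))$ put $\|x\|=\inf\{\lambda\in\mathbb{R}_+: x\in\lambda U\}$. It is assumed that $\|\cdot\|$ is a norm, that $X$ is complete for it, and that $X_+$ is closed; then $(X,X_+,\mathcal{K},f)$ (or simply $X$) is an abstract state space. A linear operator $T:X\to X$ is positive if $Tx\ge 0$ whenever $x\ge 0$; a positive linear operator with $T(\mathcal{K})\subset\mathcal{K}$ is called Markov. A $C_0$-Markov semigroup is a family $\mathcal{T}=(T_t)_{t\ge0}$ of Markov operators on $X$ with $T_0=I$, $T_{t+s}=T_tT_s$ for all $t,s\ge0$, and $\|T_tx-x\|\to0$ as $t\downarrow0$ for every $x\in X$. $\Xi(X)$ is the set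 of all $C_0$-Markov semigroups on $X$. For $t>0$ the Cesàro averages are $\mathcal{A}_t(\mathcal{T})=\frac1t\int_0^tT_s\,ds$, the integral being taken in the strong operator topology. For a projection $Q$ on $X$, $\mathcal{T}$ is mean-$Q$-ergodic if $\lim_{t\to\infty}\|\mathcal{A}_t(\mathcal{T})x-Qx\|=0$ for every $x\in X$, and uniform mean-$Q$-ergodic if $\lim_{t\to\infty}\|\mathcal{A}_t(\mathcal{T})-Q\|=0$ (operator norm). Generalized Dobrushin ergodicity coefficient: for a bounded linear operator $T$ on $X$ and a projection $Q$, $\delta_Q(T)=\sup\{\|Tx\|/\|x\|: x\in N_Q,\ x\ne0\}$, where $N_Q=\{x\in X:Qx=0\}$; if $Q=I$, one puts $\delta_Q(T)=1$.
   Formalization: The formal statement additionally assumes Q ≠ I: for Q = I, with the convention δ_I(T) = 1, the identity semigroup is uniform mean-I-ergodic but (ii) never holds, so the equivalence fails there. *)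

theory Defs
  imports "HOL-Analysis.Analysis"
begin

definition state_set :: "('a::{real_vector, ord} \<Rightarrow> real) \<Rightarrow> 'a set" where
  "state_set f = {x. 0 \<le> x \<and> f x = 1}"

definition cone_base :: "'a::real_vector set \<Rightarrow> 'a set \<Rightarrow> bool" where
  "cone_base B P \<longleftrightarrow> convex B \<and> B \<subseteq> P \<and>
     (\<forall>x\<in>P. x \<noteq> 0 \<longrightarrow> (\<exists>!(c, b). 0 < c \<and> b \<in> B \<and> x = c *\<^sub>R b))"

definition base_gauge :: "('a::{real_vector, ord} \<Rightarrow> real) \<Rightarrow> 'a \<Rightarrow> real" where
  "base_gauge f x =
     Inf {c. 0 \<le> c \<and> x \<in> (\<lambda>u. c *\<^sub>R u) ` (convex hull (state_set f \<union> uminus ` state_set f))}"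

text \<open>The ordered vector space is the carrier type, with positive cone \<open>{x. 0 \<le> x}\<close>. That the
  gauge is a complete norm is expressed by identifying it with the norm of the class \<open>banach\<close>;
  in particular, \<open>closed\<close> refers to the topology of that norm.\<close>

locale abstract_state_space =
  fixes f :: "'a::{banach, ordered_real_vector} \<Rightarrow> real"
  assumes generating: "\<exists>y z. 0 \<le> y \<and> 0 \<le> z \<and> x = y - z"
    and linear_functional: "linear f"
    and strictly_positive: "0 \<le> x \<Longrightarrow> x \<noteq> 0 \<Longrightarrow> 0 < f x"
    and base: "cone_base (state_set f) {x. 0 \<le> x}"
    and norm_eq_gauge: "norm x = base_gauge f x"
    and closed_cone: "closed {x::'a. 0 \<le> x}"

definition markov_operator ::
    "('a::{real_vector, ord} \<Rightarrow> real) \<Rightarrow> ('a \<Rightarrow> 'a) \<Rightarrow> bool" where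
  "markov_operator f T \<longleftrightarrow>
     linear T \<and> (\<forall>x. 0 \<le> x \<longrightarrow> 0 \<le> T x) \<and> T ` state_set f \<subseteq> state_set f"

text \<open>Families indexed by \<open>t \<ge> 0\<close> are functions on \<open>real\<close> whose values at negative arguments
  are irrelevant.\<close>

definition C0_markov_semigroup ::
    "('a::{real_normed_vector, ord} \<Rightarrow> real) \<Rightarrow> (real \<Rightarrow> 'a \<Rightarrow> 'a) \<Rightarrow> bool" where
  "C0_markov_semigroup f T \<longleftrightarrow>
     (\<forall>t\<ge>0. markov_operator f (T t)) \<and>
     T 0 = id \<and>
     (\<forall>t\<ge>0. \<forall>s\<ge>0. T (t + s) = T t \<circ> T s) \<and>
     (\<forall>x. ((\<lambda>t. norm (T t x - x)) \<longlongrightarrow> 0) (at_right 0))"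

text \<open>The integral in the strong operator topology is the pointwise integral of the orbits
  \<open>s \<mapsto> T s x\<close>. Only \<open>t > 0\<close> is meaningful: by totality the value at \<open>t = 0\<close> is \<open>0\<close>.\<close>

definition cesaro :: "(real \<Rightarrow> 'a \<Rightarrow> 'a::real_normed_vector) \<Rightarrow> real \<Rightarrow> 'a \<Rightarrow> 'a" where
  "cesaro T t x = (1 / t) *\<^sub>R integral {0..t} (\<lambda>s. T s x)"

text \<open>Boundedness is not part of this notion; for the limit of the averages of a Markov
  semigroup it is automatic, the averages being contractions.\<close>

definition is_projection :: "('a::real_vector \<Rightarrow> 'a) \<Rightarrow> bool" where
  "is_projection Q \<longleftrightarrow> linear Q \<and> Q \<circ> Q = Q"

definition mean_ergodic ::
    "('a::real_normed_vector \<Rightarrow> 'a) \<Rightarrow> (real \<Rightarrow> 'a \<Rightarrow> 'a) \<Rightarrow> bool" where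
  "mean_ergodic Q T \<longleftrightarrow> (\<forall>x. ((\<lambda>t. norm (cesaro T t x - Q x)) \<longlongrightarrow> 0) at_top)"

definition uniform_mean_ergodic ::
    "('a::real_normed_vector \<Rightarrow> 'a) \<Rightarrow> (real \<Rightarrow> 'a \<Rightarrow> 'a) \<Rightarrow> bool" where
  "uniform_mean_ergodic Q T \<longleftrightarrow> ((\<lambda>t. onorm (\<lambda>x. cesaro T t x - Q x)) \<longlongrightarrow> 0) at_top"

text \<open>For a projection \<open>Q \<noteq> id\<close> and a bounded operator \<open>S\<close> the set below is nonempty and bounded
  above, so \<open>Sup\<close> is a genuine supremum. For \<open>Q = id\<close> the value \<open>1\<close> is a convention, under which the
  coefficient is never below \<open>1\<close>, even for the averages of the identity semigroup.\<close>

definition dobrushin ::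
    "('a::real_normed_vector \<Rightarrow> 'a) \<Rightarrow> ('a \<Rightarrow> 'a) \<Rightarrow> real" where
  "dobrushin Q S =
     (if Q = id then 1 else Sup {norm (S x) / norm x | x. Q x = 0 \<and> x \<noteq> 0})"

end

theory Submission
  imports Defs
begin

text \<open>A Markov operator maps the set \<open>conv (K \<union> - K)\<close>, whose gauge is the norm, into itself
  (\<open>markov_operator_contraction\<close>), so a \<open>C\<^sub>0\<close>-Markov semigroup is a strongly continuous semigroup of
  contractions. Its Cesaro averages \<open>A\<^sub>t\<close> are commuting contractions, and the telescoping identity
  \<open>\<integral>\<^sub>0\<^sup>r T\<^sub>u (x - T\<^sub>s x) du = \<integral>\<^sub>0\<^sup>s T\<^sub>u x du - \<integral>\<^sub>r\<^bsup>r+s\<^esup> T\<^sub>u x du\<close>, averaged over \<open>s \<in> [0, t]\<close>, gives the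
  estimate \<open>\<parallel>A\<^sub>r (x - A\<^sub>t x)\<parallel> \<le> (t / r) \<parallel>x\<parallel>\<close> of \<open>cesaro_defect_bound\<close>.

  Letting \<open>r \<rightarrow> \<infinity>\<close> in this estimate shows \<open>Q A\<^sub>t = Q\<close>, and \<open>A\<^sub>t Q = Q\<close> because
  the averages commute with their limit. Hence \<open>A\<^sub>t - Q = A\<^sub>t (I - Q)\<close>, and the averages leave
  the kernel of \<open>Q\<close> invariant. If \<open>\<delta> < 1\<close> is the Dobrushin coefficient of
  \<open>A\<^bsub>t0\<^esub>\<close> and \<open>Q y = 0\<close>, the splitting \<open>A\<^sub>t y = A\<^sub>t (y - A\<^bsub>t0\<^esub> y) + A\<^bsub>t0\<^esub> (A\<^sub>t y)\<close> yields
  \<open>\<parallel>A\<^sub>t y\<parallel> \<le> (t0 / t) \<parallel>y\<parallel> + \<delta> \<parallel>A\<^sub>t y\<parallel>\<close>. Solving for \<open>\<parallel>A\<^sub>t y\<parallel>\<close> and inserting \<open>y = x - Q x\<close>, whose norm is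
  at most \<open>2 \<parallel>x\<parallel>\<close>, is the quantitative bound, and it forces uniform convergence. Conversely, on the
  kernel of \<open>Q\<close> the operators \<open>A\<^sub>t\<close> and \<open>A\<^sub>t - Q\<close> agree, so the Dobrushin coefficient of \<open>A\<^sub>t\<close> is at
  most \<open>\<parallel>A\<^sub>t - Q\<parallel>\<close>, which eventually drops below \<open>1\<close>.\<close>

section \<open>Markov operators are contractions\<close>

lemma markov_operator_image_hull:
  assumes "markov_operator f T"
  shows "T ` (convex hull (state_set f \<union> uminus ` state_set f))
           \<subseteq> convex hull (state_set f \<union> uminus ` state_set f)"
proof -
  have lin: "linear T" and im: "T ` state_set f \<subseteq> state_set f"
    using assms by (auto simp: markov_operator_def)
  have "T ` (state_set f \<union> uminus ` state_set f) \<subseteq> state_set f \<union> uminus ` state_set f"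
    using im by (auto simp: linear_neg[OF lin])
  then show ?thesis
    by (simp add: convex_hull_linear_image[OF lin] hull_mono)
qed

context abstract_state_space
begin

lemma state_set_nonempty:
  assumes "(x::'a) \<noteq> 0"
  shows "state_set f \<noteq> {}"
proof -
  obtain y z :: 'a where "0 \<le> y" "0 \<le> z" "x = y - z"
    using generating by blast
  then obtain p :: 'a where "0 \<le> p" "p \<noteq> 0"
    using assms by (cases "y = 0") auto
  then obtain c b where "b \<in> state_set f" "p = c *\<^sub>R b"
    using base unfolding cone_base_def by blast
  then show ?thesis by blast
qed

lemma positive_is_scaled_state:
  assumes "0 \<le> y" and "state_set f \<noteq> {}"
  obtains c k where "0 \<le> c" "k \<in> state_set f" "y = c *\<^sub>R k"
proof (cases "y = 0")
  case True
  obtain k where "k \<in> state_set f"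
    using assms(2) by blast
  then show ?thesis
    using that[of 0 k] True by simp
next
  case False
  then obtain c k where "0 < c" "k \<in> state_set f" "y = c *\<^sub>R k"
    using base assms(1) unfolding cone_base_def by blast
  then show ?thesis
    using that[of c k] by simp
qed

text \<open>The gauge is an infimum over a nonempty set, so it can be compared along inclusions of these
  sets; the infimum of the empty set has no usable value.\<close>

lemma gauge_set_nonempty:
  assumes "x \<noteq> 0"
  shows "\<exists>c\<ge>0. x \<in> (\<lambda>u. c *\<^sub>R u) ` (convex hull (state_set f \<union> uminus ` state_set f))"
proof -
  let ?U = "convex hull (state_set f \<union> uminus ` state_set f)"
  note ne = state_set_nonempty[OF assms]
  obtain y z where yz: "0 \<le> y" "0 \<le> z" "x = y - z"
    using generating by blast
  obtain a k where a: "0 \<le> a" "k \<in> state_set f" "y = a *\<^sub>R k"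
    using positive_is_scaled_state[OF yz(1) ne] .
  obtain b l where b: "0 \<le> b" "l \<in> state_set f" "z = b *\<^sub>R l"
    using positive_is_scaled_state[OF yz(2) ne] .
  have pos: "a + b > 0"
    using a b yz(3) assms by (cases "a = 0"; cases "b = 0") auto
  have "k \<in> ?U" "- l \<in> ?U"
    using a(2) b(2) by (auto intro!: hull_inc)
  then have "(a / (a + b)) *\<^sub>R k + (b / (a + b)) *\<^sub>R (- l) \<in> ?U"
    using pos a(1) b(1)
    by (intro convexD[OF convex_convex_hull]) (auto simp flip: add_divide_distrib)
  moreover have "x = (a + b) *\<^sub>R ((a / (a + b)) *\<^sub>R k + (b / (a + b)) *\<^sub>R (- l))"
    using pos by (simp add: yz(3) a(3) b(3) scaleR_diff_right)
  ultimately show ?thesis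
    using pos by (intro exI[of _ "a + b"]) auto
qed

lemma markov_operator_contraction:
  assumes "markov_operator f T"
  shows "norm (T x) \<le> norm x"
proof (cases "x = 0")
  case True
  then show ?thesis
    using assms by (simp add: markov_operator_def linear_0)
next
  case False
  let ?U = "convex hull (state_set f \<union> uminus ` state_set f)"
  let ?C = "\<lambda>x. {c. 0 \<le> c \<and> x \<in> (\<lambda>u. c *\<^sub>R u) ` ?U}"
  have lin: "linear T"
    using assms by (simp add: markov_operator_def)
  have "?C x \<noteq> {}"
    using gauge_set_nonempty[OF False] by auto
  moreover have "bdd_below (?C (T x))"
    by (rule bdd_belowI[of _ 0]) auto
  moreover have "T u \<in> ?U" if "u \<in> ?U" for u
    using markov_operator_image_hull[OF assms] that by blast
  then have "?C x \<subseteq> ?C (T x)"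
    by (auto simp: linear_scale[OF lin])
  ultimately have "Inf (?C (T x)) \<le> Inf (?C x)"
    by (rule cInf_superset_mono)
  then show ?thesis
    by (simp add: norm_eq_gauge base_gauge_def)
qed

end

section \<open>Cesaro averages of contraction semigroups\<close>

locale contraction_semigroup =
  fixes T :: "real \<Rightarrow> 'a::banach \<Rightarrow> 'a"
  assumes linear: "0 \<le> t \<Longrightarrow> linear (T t)"
    and contraction: "0 \<le> t \<Longrightarrow> norm (T t x) \<le> norm x"
    and zero: "T 0 x = x"
    and add: "0 \<le> t \<Longrightarrow> 0 \<le> s \<Longrightarrow> T (t + s) x = T t (T s x)"
    and strongly_continuous: "((\<lambda>t. T t x) \<longlongrightarrow> x) (at_right 0)"
begin

lemma bounded_linear: "0 \<le> t \<Longrightarrow> bounded_linear (T t)"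
  using linear[of t] contraction[of t]
  by (intro bounded_linear_intro[of _ 1]) (auto simp: linear_add linear_scale)

lemma commute: "0 \<le> t \<Longrightarrow> 0 \<le> s \<Longrightarrow> T t (T s x) = T s (T t x)"
  using add[of t s x] add[of s t x] by (simp add: add.commute)

text \<open>Right continuity at \<open>0\<close> spreads to all times, because contractivity gives
  \<open>\<parallel>T\<^sub>t x - T\<^sub>s x\<parallel> \<le> \<parallel>T\<^bsub>\<bar>t - s\<bar>\<^esub> x - x\<parallel>\<close>.\<close>

lemma continuous_on_orbit: "continuous_on {0..} (\<lambda>t. T t x)"
proof -
  have mod: "norm (T t x - T s x) \<le> norm (T \<bar>t - s\<bar> x - x)" if "0 \<le> t" "0 \<le> s" for t s
  proof -
    have *: "norm (T v x - T u x) \<le> norm (T (v - u) x - x)" if "0 \<le> u" "u \<le> v" for u v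
    proof -
      have "T v x - T u x = T u (T (v - u) x - x)"
        using add[of u "v - u" x] that linear[of u] by (simp add: linear_diff)
      then show ?thesis
        using contraction[of u] that by simp
    qed
    show ?thesis
      using *[of s t] *[of t s] that
      by (cases "s \<le> t") (auto simp: norm_minus_commute abs_real_def)
  qed
  show ?thesis
    unfolding continuous_on_iff
  proof (intro ballI allI impI)
    fix t e :: real
    assume t: "t \<in> {0..}" and e: "0 < e"
    from tendstoD[OF strongly_continuous[of x] e]
    obtain d where d: "d > 0" "\<And>h. 0 < h \<Longrightarrow> h < d \<Longrightarrow> dist (T h x) x < e"
      unfolding eventually_at_right_field by auto
    have "dist (T s x) (T t x) < e" if "0 \<le> s" "dist s t < d" for s
    proof -
      have "norm (T \<bar>s - t\<bar> x - x) < e"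
        using d(2)[of "\<bar>s - t\<bar>"] that e
        by (cases "s = t") (auto simp: dist_norm zero)
      then show ?thesis
        using mod[of s t] t that by (simp add: dist_norm)
    qed
    then show "\<exists>d>0. \<forall>s\<in>{0..}. dist s t < d \<longrightarrow> dist (T s x) (T t x) < e"
      using d(1) by auto
  qed
qed

lemma integrable_orbit: "0 \<le> a \<Longrightarrow> (\<lambda>s. T s x) integrable_on {a..b}"
  by (intro integrable_continuous_real continuous_on_subset[OF continuous_on_orbit]) auto

lemma norm_integral_orbit_le:
  assumes "0 \<le> a" "a \<le> b"
  shows "norm (integral {a..b} (\<lambda>s. T s x)) \<le> (b - a) * norm x"
proof -
  have "norm (integral {a..b} (\<lambda>s. T s x)) \<le> norm x * (b - a)"
    using assms contraction
    by (intro integral_bound continuous_on_subset[OF continuous_on_orbit]) auto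
  then show ?thesis by (simp add: mult.commute)
qed

lemma norm_cesaro_le:
  assumes "0 < t"
  shows "norm (cesaro T t x) \<le> norm x"
  using norm_integral_orbit_le[of 0 t x] assms by (simp add: cesaro_def field_simps)

lemma bounded_linear_cesaro:
  assumes "0 < t"
  shows "bounded_linear (cesaro T t)"
proof (rule bounded_linear_intro[of _ 1])
  fix x y :: 'a and c :: real
  have "integral {0..t} (\<lambda>s. T s (x + y)) = integral {0..t} (\<lambda>s. T s x + T s y)"
    by (intro integral_cong) (auto simp: linear linear_add)
  then show "cesaro T t (x + y) = cesaro T t x + cesaro T t y"
    by (simp add: cesaro_def integral_add integrable_orbit scaleR_add_right)
  have "integral {0..t} (\<lambda>s. T s (c *\<^sub>R x)) = integral {0..t} (\<lambda>s. c *\<^sub>R T s x)"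
    by (intro integral_cong) (auto simp: linear linear_scale)
  then show "cesaro T t (c *\<^sub>R x) = c *\<^sub>R cesaro T t x"
    by (simp add: cesaro_def)
  show "norm (cesaro T t x) \<le> norm x * 1"
    using norm_cesaro_le[OF assms] by simp
qed

lemma bounded_linear_apply_cesaro:
  assumes "bounded_linear L"
  shows "L (cesaro T t x) = (1 / t) *\<^sub>R integral {0..t} (\<lambda>s. L (T s x))"
  using integral_linear[OF integrable_orbit[of 0 x t] assms]
  by (simp add: cesaro_def o_def linear_simps(5)[OF assms])

lemma cesaro_commute_orbit:
  assumes "0 < t" "0 \<le> s"
  shows "cesaro T t (T s x) = T s (cesaro T t x)"
proof -
  have "integral {0..t} (\<lambda>u. T u (T s x)) = integral {0..t} (\<lambda>u. T s (T u x))"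
    using assms by (intro integral_cong) (auto intro: commute)
  then show ?thesis
    using bounded_linear_apply_cesaro[OF bounded_linear[OF assms(2)]]
    by (simp add: cesaro_def)
qed

text \<open>Applying the bounded operator \<open>A\<^sub>t\<close> under the integral that defines \<open>A\<^sub>r\<close> reduces this to the
  commutation of \<open>A\<^sub>t\<close> with a single \<open>T\<^sub>s\<close>; interchanging two integrals is avoided.\<close>

lemma cesaro_commute:
  assumes "0 < t" "0 < r"
  shows "cesaro T t (cesaro T r x) = cesaro T r (cesaro T t x)"
proof -
  have "integral {0..r} (\<lambda>s. cesaro T t (T s x)) = integral {0..r} (\<lambda>s. T s (cesaro T t x))"
    using assms by (intro integral_cong) (auto intro: cesaro_commute_orbit)
  then show ?thesis
    using bounded_linear_apply_cesaro[OF bounded_linear_cesaro[OF assms(1)], of r x]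
    by (simp add: cesaro_def[of T r "cesaro T t x"])
qed

text \<open>The orbit integrals over \<open>[0, r]\<close> and over its translate \<open>[s, r + s]\<close> differ only by two
  integrals over intervals of length \<open>s\<close>.\<close>

lemma norm_cesaro_orbit_defect_le:
  assumes "0 < r" "0 \<le> s"
  shows "norm (cesaro T r (x - T s x)) \<le> 2 * s / r * norm x"
proof -
  let ?I = "\<lambda>a b. integral {a..b} (\<lambda>u. T u x)"
  have "((\<lambda>u. T u x) has_integral ?I s (r + s)) {s..r + s}"
    using assms integrable_orbit by blast
  from has_integral_affinity[of "\<lambda>u. T u x" _ s "r + s" 1 s] this
  have "((\<lambda>u. T (u + s) x) has_integral ?I s (r + s)) ((\<lambda>u. u - s) ` {s..r + s})"
    by simp
  then have "((\<lambda>u. T (u + s) x) has_integral ?I s (r + s)) {0..r}"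
    by simp
  moreover have "integral {0..r} (\<lambda>u. T u (T s x)) = integral {0..r} (\<lambda>u. T (u + s) x)"
    using assms by (intro integral_cong) (auto simp: add)
  ultimately have shift: "integral {0..r} (\<lambda>u. T u (T s x)) = ?I s (r + s)"
    by (simp add: integral_unique)
  have "?I 0 s + ?I s (r + s) = ?I 0 (r + s)" "?I 0 r + ?I r (r + s) = ?I 0 (r + s)"
    using assms by (auto intro!: Henstock_Kurzweil_Integration.integral_combine integrable_orbit)
  then have tele: "?I 0 r - ?I s (r + s) = ?I 0 s - ?I r (r + s)"
    by (simp add: algebra_simps)
  have "cesaro T r (x - T s x) = cesaro T r x - cesaro T r (T s x)"
    by (rule linear_simps(2)[OF bounded_linear_cesaro[OF assms(1)]])
  also have "\<dots> = (1 / r) *\<^sub>R (?I 0 s - ?I r (r + s))"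
    by (simp add: cesaro_def shift tele flip: scaleR_diff_right)
  finally have "norm (cesaro T r (x - T s x)) = norm (?I 0 s - ?I r (r + s)) / r"
    using assms by simp
  also have "norm (?I 0 s - ?I r (r + s)) \<le> s * norm x + s * norm x"
    using norm_integral_orbit_le[of 0 s x] norm_integral_orbit_le[of r "r + s" x] assms
    by (intro order_trans[OF norm_triangle_ineq4]) simp
  finally show ?thesis
    using assms by (simp add: divide_right_mono mult_ac)
qed

text \<open>Averaging the previous bound over \<open>s \<in> [0, t]\<close> turns \<open>2 s\<close> into \<open>t\<close>. This is what makes
  \<open>2 t0\<close>, and not \<open>4 t0\<close>, the constant in the final rate.\<close>

lemma cesaro_defect_bound:
  assumes "0 < r" "0 < t"
  shows "norm (cesaro T r (x - cesaro T t x)) \<le> t / r * norm x"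
proof -
  note bl = bounded_linear_cesaro[OF assms(1)]
  let ?D = "\<lambda>s. cesaro T r (x - T s x)"
  have int: "?D integrable_on {0..t}"
    by (intro integrable_continuous_real bounded_linear.continuous_on[OF bl] continuous_intros
        continuous_on_subset[OF continuous_on_orbit]) auto
  have lin_int: "(\<lambda>s. 2 * s / r * norm x) integrable_on {0..t}"
    by (intro integrable_continuous_real continuous_intros) (use assms in auto)
  have ident: "integral {0..t} (\<lambda>s::real. s) = t\<^sup>2 / 2"
    using ident_has_integral[of 0 t] assms by (simp add: integral_unique)
  have "integral {0..t} ?D = integral {0..t} (\<lambda>s. cesaro T r x - cesaro T r (T s x))"
    by (simp add: linear_simps(2)[OF bl])
  also have "\<dots> = t *\<^sub>R cesaro T r x - integral {0..t} (\<lambda>s. cesaro T r (T s x))"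
    using assms integrable_linear[OF integrable_orbit[of 0 x t] bl]
    by (subst integral_diff) (auto simp: o_def)
  finally have "cesaro T r (x - cesaro T t x) = (1 / t) *\<^sub>R integral {0..t} ?D"
    using assms
    by (simp add: linear_simps(2)[OF bl] bounded_linear_apply_cesaro[OF bl] scaleR_diff_right)
  then have "norm (cesaro T r (x - cesaro T t x)) = norm (integral {0..t} ?D) / t"
    using assms by simp
  also have "norm (integral {0..t} ?D) \<le> integral {0..t} (\<lambda>s. 2 * s / r * norm x)"
    using assms by (intro integral_norm_bound_integral int lin_int norm_cesaro_orbit_defect_le) auto
  also have "integral {0..t} (\<lambda>s. 2 * s / r * norm x) = integral {0..t} (\<lambda>s. (2 / r * norm x) * s)"
    by (simp add: mult_ac)
  also have "\<dots> = t\<^sup>2 / r * norm x"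
    by (simp only: integral_mult_right ident) simp
  finally show ?thesis
    using assms by (simp add: divide_right_mono power2_eq_square)
qed

end

section \<open>The mean ergodic projection\<close>

locale mean_ergodic_semigroup = contraction_semigroup T
  for T :: "real \<Rightarrow> 'a::banach \<Rightarrow> 'a" +
  fixes Q :: "'a \<Rightarrow> 'a"
  assumes projection: "is_projection Q"
    and mean_ergodic: "mean_ergodic Q T"
begin

lemma cesaro_tendsto: "((\<lambda>r. cesaro T r x) \<longlongrightarrow> Q x) at_top"
  using mean_ergodic unfolding mean_ergodic_def
  by (simp add: tendsto_norm_zero_iff LIM_zero_iff)

lemma Q_diff: "Q (x - y) = Q x - Q y"
  using projection by (simp add: is_projection_def linear_diff)

lemma Q_idem: "Q (Q x) = Q x"
  using projection by (simp add: is_projection_def fun_eq_iff)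

lemma norm_Q_le: "norm (Q x) \<le> norm x"
proof (rule tendsto_upperbound[OF tendsto_norm[OF cesaro_tendsto]])
  show "\<forall>\<^sub>F r in at_top. norm (cesaro T r x) \<le> norm x"
    using eventually_gt_at_top[of 0] by eventually_elim (rule norm_cesaro_le)
qed simp

lemma bounded_linear_Q: "bounded_linear Q"
  using projection norm_Q_le
  by (intro bounded_linear_intro[of _ 1]) (auto simp: is_projection_def linear_add linear_scale)

lemma bounded_linear_cesaro_diff_Q:
  "0 < t \<Longrightarrow> bounded_linear (\<lambda>x. cesaro T t x - Q x)"
  by (intro bounded_linear_sub bounded_linear_cesaro bounded_linear_Q)

lemma cesaro_commute_tendsto:
  assumes "0 < t"
  shows "((\<lambda>r. cesaro T r (cesaro T t x)) \<longlongrightarrow> cesaro T t (Q x)) at_top"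
proof (rule Lim_transform_eventually)
  show "((\<lambda>r. cesaro T t (cesaro T r x)) \<longlongrightarrow> cesaro T t (Q x)) at_top"
    by (intro bounded_linear.tendsto[OF bounded_linear_cesaro[OF assms]] cesaro_tendsto)
  show "\<forall>\<^sub>F r in at_top. cesaro T t (cesaro T r x) = cesaro T r (cesaro T t x)"
    using eventually_gt_at_top[of 0] by eventually_elim (simp add: cesaro_commute assms)
qed

lemma Q_cesaro_commute:
  assumes "0 < t"
  shows "Q (cesaro T t x) = cesaro T t (Q x)"
  by (rule tendsto_unique[OF _ cesaro_tendsto cesaro_commute_tendsto[OF assms]]) simp

text \<open>The averages of \<open>x - A\<^sub>t x\<close> tend to \<open>Q (x - A\<^sub>t x)\<close> and, by the defect bound, to \<open>0\<close>.\<close>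

lemma Q_cesaro:
  assumes "0 < t"
  shows "Q (cesaro T t x) = Q x"
proof -
  have "((\<lambda>r. t / r * norm x) \<longlongrightarrow> 0) at_top"
    by (intro tendsto_mult_left_zero tendsto_divide_0[OF tendsto_const]
        filterlim_at_top_imp_at_infinity filterlim_ident)
  moreover have "\<forall>\<^sub>F r in at_top. norm (cesaro T r (x - cesaro T t x)) \<le> t / r * norm x"
    using eventually_gt_at_top[of 0] by eventually_elim (rule cesaro_defect_bound[OF _ assms])
  ultimately have "((\<lambda>r. cesaro T r (x - cesaro T t x)) \<longlongrightarrow> 0) at_top"
    by (rule Lim_null_comparison[rotated])
  from tendsto_unique[OF _ cesaro_tendsto this] show ?thesis
    by (simp add: Q_diff)
qed

lemma cesaro_Q: "0 < t \<Longrightarrow> cesaro T t (Q x) = Q x"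
  using Q_cesaro[of t x] Q_cesaro_commute[of t x] by simp

lemma cesaro_diff_Q: "0 < t \<Longrightarrow> cesaro T t x - Q x = cesaro T t (x - Q x)"
  by (simp add: linear_simps(2)[OF bounded_linear_cesaro] cesaro_Q)

section \<open>Uniform convergence and the Dobrushin coefficient\<close>

lemma norm_cesaro_le_dobrushin:
  assumes "Q \<noteq> id" "0 < t" "Q y = 0"
  shows "norm (cesaro T t y) \<le> dobrushin Q (cesaro T t) * norm y"
proof (cases "y = 0")
  case True
  then show ?thesis
    by (simp add: linear_simps(3)[OF bounded_linear_cesaro[OF assms(2)]])
next
  case False
  let ?R = "{norm (cesaro T t x) / norm x | x. Q x = 0 \<and> x \<noteq> 0}"
  have "bdd_above ?R"
    using norm_cesaro_le[OF assms(2)] by (intro bdd_aboveI[of _ 1]) auto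
  then have "norm (cesaro T t y) / norm y \<le> Sup ?R"
    using False assms(3) by (intro cSup_upper) auto
  then show ?thesis
    using False assms(1) by (simp add: dobrushin_def divide_le_eq)
qed

lemma dobrushin_le_onorm:
  assumes "Q \<noteq> id" "0 < t"
  shows "dobrushin Q (cesaro T t) \<le> onorm (\<lambda>x. cesaro T t x - Q x)"
proof -
  let ?R = "{norm (cesaro T t x) / norm x | x. Q x = 0 \<and> x \<noteq> 0}"
  obtain x where "Q x \<noteq> x"
    using assms(1) by (auto simp: fun_eq_iff)
  then have "Q (x - Q x) = 0" "x - Q x \<noteq> 0"
    by (auto simp: Q_diff Q_idem)
  then have "?R \<noteq> {}" by blast
  moreover have "c \<le> onorm (\<lambda>x. cesaro T t x - Q x)" if c: "c \<in> ?R" for c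
  proof -
    obtain y where "c = norm (cesaro T t y) / norm y" "Q y = 0" "y \<noteq> 0"
      using c by blast
    then show ?thesis
      using onorm[OF bounded_linear_cesaro_diff_Q[OF assms(2)], of y]
      by (simp add: divide_le_eq)
  qed
  ultimately have "Sup ?R \<le> onorm (\<lambda>x. cesaro T t x - Q x)"
    by (rule cSup_least)
  then show ?thesis
    using assms(1) by (simp add: dobrushin_def)
qed

text \<open>The contraction factor of \<open>A\<^bsub>t0\<^esub>\<close> acts on \<open>A\<^sub>t y\<close>, which is in the kernel of \<open>Q\<close> again, and the resulting
  inequality for \<open>\<parallel>A\<^sub>t y\<parallel>\<close> is solved; a Neumann series for \<open>(I - A\<^bsub>t0\<^esub>)\<^sup>-\<^sup>1\<close> on the kernel would give
  the same constant.\<close>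

lemma norm_cesaro_kernel_le:
  assumes "Q \<noteq> id" "0 < t0" "dobrushin Q (cesaro T t0) < 1" "0 < t" "Q y = 0"
  shows "norm (cesaro T t y) \<le> t0 / (1 - dobrushin Q (cesaro T t0)) * (1 / t) * norm y"
proof -
  let ?d = "dobrushin Q (cesaro T t0)"
  have "Q (cesaro T t y) = 0"
    using assms by (simp add: Q_cesaro)
  then have "norm (cesaro T t0 (cesaro T t y)) \<le> ?d * norm (cesaro T t y)"
    by (rule norm_cesaro_le_dobrushin[OF assms(1,2)])
  moreover have "norm (cesaro T t (y - cesaro T t0 y)) \<le> t0 / t * norm y"
    by (rule cesaro_defect_bound[OF assms(4,2)])
  moreover have "cesaro T t y = cesaro T t (y - cesaro T t0 y) + cesaro T t0 (cesaro T t y)"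
    using assms
    by (simp add: linear_simps(2)[OF bounded_linear_cesaro] cesaro_commute[of t0 t])
  then have "norm (cesaro T t y)
      \<le> norm (cesaro T t (y - cesaro T t0 y)) + norm (cesaro T t0 (cesaro T t y))"
    by (metis norm_triangle_ineq)
  ultimately have "(1 - ?d) * norm (cesaro T t y) \<le> t0 / t * norm y"
    by (simp add: algebra_simps)
  then have "norm (cesaro T t y) \<le> t0 / t * norm y / (1 - ?d)"
    using assms(3) by (subst pos_le_divide_eq) (simp_all add: mult.commute)
  then show ?thesis
    by (simp add: mult_ac)
qed

lemma onorm_cesaro_diff_Q_le:
  assumes "Q \<noteq> id" "0 < t0" "dobrushin Q (cesaro T t0) < 1" "0 < t"
  shows "onorm (\<lambda>x. cesaro T t x - Q x) \<le> 2 * t0 / (1 - dobrushin Q (cesaro T t0)) * (1 / t)"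
proof (rule onorm_bound)
  show "0 \<le> 2 * t0 / (1 - dobrushin Q (cesaro T t0)) * (1 / t)"
    using assms by simp
next
  fix x
  let ?C = "t0 / (1 - dobrushin Q (cesaro T t0)) * (1 / t)"
  have "norm (cesaro T t x - Q x) \<le> ?C * norm (x - Q x)"
    unfolding cesaro_diff_Q[OF assms(4)]
    by (rule norm_cesaro_kernel_le[OF assms]) (simp add: Q_diff Q_idem)
  also have "\<dots> \<le> ?C * (2 * norm x)"
  proof (rule mult_left_mono)
    show "norm (x - Q x) \<le> 2 * norm x"
      using norm_triangle_ineq4[of x "Q x"] norm_Q_le[of x] by linarith
    show "0 \<le> ?C"
      using assms by simp
  qed
  finally show "norm (cesaro T t x - Q x)
      \<le> 2 * t0 / (1 - dobrushin Q (cesaro T t0)) * (1 / t) * norm x"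
    by (simp add: mult_ac)
qed

lemma uniform_mean_ergodic_iff_dobrushin:
  assumes "Q \<noteq> id"
  shows "uniform_mean_ergodic Q T \<longleftrightarrow> (\<exists>t0>0. dobrushin Q (cesaro T t0) < 1)"
proof
  assume "uniform_mean_ergodic Q T"
  then have "\<forall>\<^sub>F t in at_top. onorm (\<lambda>x. cesaro T t x - Q x) < 1"
    unfolding uniform_mean_ergodic_def by (rule order_tendstoD) simp
  then have "\<forall>\<^sub>F t in at_top. 0 < t \<and> onorm (\<lambda>x. cesaro T t x - Q x) < 1"
    using eventually_gt_at_top[of "0::real"] by eventually_elim simp
  then obtain t where "0 < t" "onorm (\<lambda>x. cesaro T t x - Q x) < 1"
    using eventually_happens'[OF trivial_limit_at_top_linorder] by blast
  then show "\<exists>t0>0. dobrushin Q (cesaro T t0) < 1"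
    using dobrushin_le_onorm[OF assms] by (intro exI[of _ t]) fastforce
next
  assume "\<exists>t0>0. dobrushin Q (cesaro T t0) < 1"
  then obtain t0 where t0: "0 < t0" "dobrushin Q (cesaro T t0) < 1"
    by blast
  let ?C = "2 * t0 / (1 - dobrushin Q (cesaro T t0))"
  show "uniform_mean_ergodic Q T"
    unfolding uniform_mean_ergodic_def
  proof (rule tendsto_sandwich[OF _ _ tendsto_const])
    show "\<forall>\<^sub>F t in at_top. 0 \<le> onorm (\<lambda>x. cesaro T t x - Q x)"
      using eventually_gt_at_top[of 0]
      by eventually_elim (rule onorm_pos_le[OF bounded_linear_cesaro_diff_Q])
    show "\<forall>\<^sub>F t in at_top. onorm (\<lambda>x. cesaro T t x - Q x) \<le> ?C * (1 / t)"
      using eventually_gt_at_top[of 0]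
      by eventually_elim (rule onorm_cesaro_diff_Q_le[OF assms t0])
    show "((\<lambda>t. ?C * (1 / t)) \<longlongrightarrow> 0) at_top"
      by (intro tendsto_mult_right_zero tendsto_divide_0[OF tendsto_const]
          filterlim_at_top_imp_at_infinity filterlim_ident)
  qed
qed

end

theorem theorem4p2:
  fixes f :: "'a::{banach, ordered_real_vector} \<Rightarrow> real"
    and Q :: "'a \<Rightarrow> 'a"
    and T :: "real \<Rightarrow> 'a \<Rightarrow> 'a"
  assumes "abstract_state_space f"
    and "is_projection Q"
    and "Q \<noteq> id"
    and "C0_markov_semigroup f T"
    and "mean_ergodic Q T"
  shows "(uniform_mean_ergodic Q T \<longleftrightarrow> (\<exists>t0>0. dobrushin Q (cesaro T t0) < 1)) \<and>
    (\<forall>t0>0. dobrushin Q (cesaro T t0) < 1 \<longrightarrow>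
       (\<forall>t>0. onorm (\<lambda>x. cesaro T t x - Q x)
                \<le> 2 * t0 / (1 - dobrushin Q (cesaro T t0)) * (1 / t)))"
proof -
  interpret mean_ergodic_semigroup T Q
  proof (intro mean_ergodic_semigroup.intro contraction_semigroup.intro
      mean_ergodic_semigroup_axioms.intro)
    fix t s :: real and x :: 'a
    have markov: "markov_operator f (T t)" if "0 \<le> t"
      using assms(4) that by (simp add: C0_markov_semigroup_def)
    show "linear (T t)" if "0 \<le> t"
      using markov[OF that] by (simp add: markov_operator_def)
    show "norm (T t x) \<le> norm x" if "0 \<le> t"
      by (rule abstract_state_space.markov_operator_contraction[OF assms(1) markov[OF that]])
    show "T 0 x = x"
      using assms(4) by (simp add: C0_markov_semigroup_def)
    show "T (t + s) x = T t (T s x)" if "0 \<le> t" "0 \<le> s"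
      using assms(4) that by (simp add: C0_markov_semigroup_def)
    have "((\<lambda>t. norm (T t x - x)) \<longlongrightarrow> 0) (at_right 0)"
      using assms(4) by (simp add: C0_markov_semigroup_def)
    then show "((\<lambda>t. T t x) \<longlongrightarrow> x) (at_right 0)"
      by (simp add: tendsto_norm_zero_iff LIM_zero_iff)
  qed (fact assms(2,5))+
  show ?thesis
    using uniform_mean_ergodic_iff_dobrushin[OF assms(3)] onorm_cesaro_diff_Q_le[OF assms(3)]
    by blast
qed

end
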